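(* Let $b_n$, $n\ge0$, be the Bernoulli numbers of the second kind, defined by $\frac{x}{\ln(1+x)}=\sum_{n=0}^\infty b_n x^n$ near $x=0$. Let $m$ be a positive integer and let $a_1,\dots,a_m$ be nonnegative integers. Then $$\bigl|(a_i+a_j)!\,b_{a_i+a_j+1}\bigr|_m\ge0$$ and $$\bigl|(-1)^{a_i+a_j}(a_i+a_j)!\,b_{a_i+a_j+1}\bigr|_m\ge0,$$ where $|a_{ij}|_m$ denotes the determinant of order $m$ with entries $a_{ij}$, $1\le i,j\le m$.
   Context: The function $x/\ln(1+x)$ is extended to $x=0$ by the value $1$; the $b_n$ are its Taylor coefficients at $0$. *)

theory Defs
  imports "HOL-Analysis.Analysis" "Jordan_Normal_Form.Determinant"
begin

definition bernoulli2_gf :: "real \<Rightarrow> real" where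
  "bernoulli2_gf x = (if x = 0 then 1 else x / ln (1 + x))"

definition bernoulli2 :: "nat \<Rightarrow> real" where
  "bernoulli2 n = (deriv ^^ n) bernoulli2_gf 0 / fact n"

text \<open>
  In Isabelle, \<^term>\<open>deriv\<close> is a total function with arbitrary values where the derivative
  does not exist. The lemma \<open>bernoulli2_sums\<close> below confirms that the numbers defined above
  are the coefficients of the convergent power series expansion of the generating function at 0.
\<close>

lemma has_fps_expansion_iterated_deriv:
  fixes f :: "real \<Rightarrow> real"
  assumes "f has_fps_expansion F"
  shows "(deriv ^^ n) f has_fps_expansion (fps_deriv ^^ n) F"
  using assms by (induction n) (auto intro: has_fps_expansion_deriv)

lemma fps_nth_eq_iterated_deriv:
  fixes f :: "real \<Rightarrow> real"
  assumes "f has_fps_expansion F"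
  shows "fps_nth F n = (deriv ^^ n) f 0 / fact n"
proof -
  have "eventually (\<lambda>z. eval_fps ((fps_deriv ^^ n) F) z = (deriv ^^ n) f z) (nhds 0)"
    using has_fps_expansion_iterated_deriv[OF assms, of n] by (simp add: has_fps_expansion_def)
  hence "fps_nth ((fps_deriv ^^ n) F) 0 = (deriv ^^ n) f 0"
    by (auto simp: eval_fps_at_0 dest: eventually_nhds_x_imp_x)
  thus ?thesis
    by (simp add: fps_0th_higher_deriv eq_divide_eq mult.commute)
qed

lemma ln_has_fps_expansion:
  "(\<lambda>x::real. ln (1 + x)) has_fps_expansion fps_ln 1"
proof -
  have rad: "fps_conv_radius (fps_ln 1 :: real fps) \<ge> 1"
    by (simp add: fps_conv_radius_ln)
  have "eval_fps (fps_ln 1) x = ln (1 + x)" if "norm x < 1" for x :: real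
  proof -
    have "(\<lambda>n. fps_nth (fps_ln 1) n * x ^ n) = (\<lambda>n. - ((-x) ^ n) / of_nat n)"
      by (rule ext, rename_tac n, case_tac n)
        (auto simp: fps_ln_def field_simps power_minus')
    thus ?thesis
      using ln_series'[of x] that by (simp add: eval_fps_def sums_iff)
  qed
  moreover have "eventually (\<lambda>x::real. norm x < 1) (nhds 0)"
    by (auto simp: eventually_nhds_metric dist_norm intro!: exI[of _ 1])
  ultimately show ?thesis
    unfolding has_fps_expansion_def using rad
    by (auto elim!: eventually_mono intro: less_le_trans[OF _ rad])
qed

lemma bernoulli2_gf_has_fps_expansion:
  "bernoulli2_gf has_fps_expansion Abs_fps bernoulli2"
proof -
  have nz: "fps_nth (fps_ln 1 :: real fps) 1 \<noteq> 0" "fps_nth (fps_ln 1 :: real fps) 0 = 0"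
    by (auto simp: fps_ln_def)
  hence sd: "subdegree (fps_ln 1 :: real fps) = 1"
    by (intro subdegreeI) auto
  have "(\<lambda>x::real. if x = 0 then 1 else x / ln (1 + x)) has_fps_expansion (fps_X / fps_ln 1)"
    by (rule has_fps_expansion_divide[OF has_fps_expansion_fps_X ln_has_fps_expansion])
      (use nz sd in auto, simp add: fps_ln_def)
  hence E: "bernoulli2_gf has_fps_expansion (fps_X / fps_ln 1)"
    by (simp add: bernoulli2_gf_def[abs_def])
  have "Abs_fps bernoulli2 = fps_X / fps_ln 1"
    by (rule fps_ext) (simp add: bernoulli2_def fps_nth_eq_iterated_deriv[OF E])
  with E show ?thesis by simp
qed

lemma bernoulli2_sums:
  "eventually (\<lambda>x. (\<lambda>n. bernoulli2 n * x ^ n) sums bernoulli2_gf x) (nhds 0)"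
proof -
  let ?F = "Abs_fps bernoulli2"
  have "fps_conv_radius ?F > 0" and ev: "eventually (\<lambda>x. eval_fps ?F x = bernoulli2_gf x) (nhds 0)"
    using bernoulli2_gf_has_fps_expansion by (auto simp: has_fps_expansion_def)
  hence "eventually (\<lambda>x. x \<in> eball 0 (fps_conv_radius ?F)) (nhds 0)"
    by (intro eventually_nhds_in_open) (auto simp: zero_ereal_def)
  with ev show ?thesis
  proof eventually_elim
    case (elim x)
    thus ?case
      using sums_eval_fps[of x ?F] by (simp add: in_eball_iff)
  qed
qed

end

theory Submission
  imports Defs
begin

text \<open>
  Integrating \<open>(1 + x) powr t = (\<Sum>n. (t gchoose n) * x ^ n)\<close> over \<open>t \<in> {0..1}\<close> gives
  \<open>b\<^sub>n = \<integral>\<^sub>0\<^sup>1 (t gchoose n) dt\<close>, hence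
  \<open>(-1)\<^sup>n n! b\<^sub>n\<^sub>+\<^sub>1 = \<integral>\<^sub>0\<^sup>1 t (1 - t)\<^sub>n / (n + 1) dt\<close> with the Pochhammer symbol \<open>(1 - t)\<^sub>n\<close>.
  As \<open>(1 - t)\<^sub>n = \<Gamma>(1 - t + n) / \<Gamma>(1 - t)\<close> is the moment sequence of a gamma distribution and
  \<open>1 / (n + 1)\<close> that of the uniform distribution on \<open>{0..1}\<close>, the numbers \<open>(-1)\<^sup>n n! b\<^sub>n\<^sub>+\<^sub>1\<close> form the
  moment sequence of a positive measure. So the matrices in question are positive semidefinite; the
  two differ by conjugation with the diagonal matrix with entries \<open>(-1)\<close> to the power \<open>a\<^sub>i\<close>.
\<close>

section \<open>Determinants and positive quadratic forms\<close>

text \<open>If the matrix were singular, the quadratic form would vanish at any nonzero kernel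
  vector.\<close>

lemma det_mat_neq_0_if_pos_def:
  fixes A :: "nat \<Rightarrow> nat \<Rightarrow> real"
  assumes "\<And>c k. k < m \<Longrightarrow> c k \<noteq> 0 \<Longrightarrow> (\<Sum>i<m. \<Sum>j<m. c i * c j * A i j) > 0"
  shows "Determinant.det (Matrix.mat m m (\<lambda>(i, j). A i j)) \<noteq> 0"
proof
  let ?M = "Matrix.mat m m (\<lambda>(i, j). A i j)"
  assume "Determinant.det ?M = 0"
  then obtain v where v: "v \<in> carrier_vec m" "v \<noteq> 0\<^sub>v m" "?M *\<^sub>v v = 0\<^sub>v m"
    using det_0_iff_vec_prod_zero[of ?M m] by auto
  from v(1,2) obtain k where k: "k < m" "vec_index v k \<noteq> 0"
    by (auto simp: Matrix.vec_eq_iff)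
  have row: "(\<Sum>j<m. A i j * vec_index v j) = 0" if "i < m" for i
  proof -
    have "vec_index (?M *\<^sub>v v) i = 0"
      using v(3) that by simp
    thus ?thesis
      using that v(1) by (simp add: scalar_prod_def lessThan_atLeast0)
  qed
  have "(\<Sum>i<m. \<Sum>j<m. vec_index v i * vec_index v j * A i j)
      = (\<Sum>i<m. vec_index v i * (\<Sum>j<m. A i j * vec_index v j))"
    by (simp add: sum_distrib_left mult_ac)
  also have "\<dots> = 0"
    using row by simp
  finally show False
    using assms[where c = "vec_index v", OF k] by simp
qed

text \<open>On the segment from the identity matrix to \<open>A\<close> the determinant cannot vanish before \<open>A\<close>.\<close>

lemma det_mat_nonneg_if_pos_semidef:
  fixes A :: "nat \<Rightarrow> nat \<Rightarrow> real"
  assumes psd: "\<And>c. (\<Sum>i<m. \<Sum>j<m. c i * c j * A i j) \<ge> 0"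
  shows "Determinant.det (Matrix.mat m m (\<lambda>(i, j). A i j)) \<ge> 0"
proof (rule ccontr)
  define B where "B t i j = t * A i j + (1 - t) * of_bool (i = j)" for t :: real and i j :: nat
  define d where "d t = Determinant.det (Matrix.mat m m (\<lambda>(i, j). B t i j))" for t
  assume "\<not> ?thesis"
  hence d1: "d 1 < 0"
    by (simp add: d_def B_def)
  have "Matrix.mat m m (\<lambda>(i, j). B 0 i j) = 1\<^sub>m m"
    by (intro eq_matI) (auto simp: B_def)
  hence d0: "d 0 = 1"
    by (simp add: d_def)
  \<comment> \<open>The Leibniz formula exhibits \<open>d\<close> as a polynomial in
    \<open>t\<close>, hence continuous.\<close>
  have "d = (\<lambda>t. \<Sum>p\<in>{p. p permutes {0..<m}}. signof p * (\<Prod>i=0..<m. B t i (p i)))"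
  proof
    fix t
    have "(\<Prod>i=0..<m. Matrix.mat m m (\<lambda>(i, j). B t i j) $$ (i, p i)) = (\<Prod>i=0..<m. B t i (p i))"
      if "p permutes {0..<m}" for p
      using permutes_in_image[OF that] by (intro prod.cong) auto
    thus "d t = (\<Sum>p\<in>{p. p permutes {0..<m}}. signof p * (\<Prod>i=0..<m. B t i (p i)))"
      unfolding d_def by (subst det_def'[of _ m]) (auto intro!: sum.cong)
  qed
  hence cont: "continuous_on {0..1} d"
    unfolding B_def by (auto intro!: continuous_intros)
  obtain t where t: "0 \<le> t" "t \<le> 1" "d t = 0"
    using IVT2'[of d 1 0 0] cont d0 d1 by auto
  with d1 have "t < 1"
    by (cases "t = 1") auto
  have "d t \<noteq> 0"
    unfolding d_def
  proof (rule det_mat_neq_0_if_pos_def)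
    fix c :: "nat \<Rightarrow> real" and k
    assume k: "k < m" "c k \<noteq> 0"
    have "(\<Sum>i<m. \<Sum>j<m. c i * c j * B t i j)
        = t * (\<Sum>i<m. \<Sum>j<m. c i * c j * A i j)
          + (1 - t) * (\<Sum>i<m. \<Sum>j<m. c i * c j * of_bool (i = j))"
      by (simp add: B_def algebra_simps sum.distrib sum_distrib_left sum_subtractf)
    also have "(\<Sum>i<m. \<Sum>j<m. c i * c j * of_bool (i = j)) = (\<Sum>i<m. (c i)\<^sup>2)"
      by (intro sum.cong refl) (simp add: of_bool_def if_distrib power2_eq_square cong: if_cong)
    finally have eq: "(\<Sum>i<m. \<Sum>j<m. c i * c j * B t i j)
        = t * (\<Sum>i<m. \<Sum>j<m. c i * c j * A i j) + (1 - t) * (\<Sum>i<m. (c i)\<^sup>2)" .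
    \<comment> \<open>As \<open>t < 1\<close>, the identity part of \<open>B t\<close> makes the
      form strictly positive.\<close>
    have "(\<Sum>i<m. (c i)\<^sup>2) > 0"
      using k by (intro sum_pos2[of _ k]) auto
    thus "(\<Sum>i<m. \<Sum>j<m. c i * c j * B t i j) > 0"
      unfolding eq using psd[of c] t \<open>t < 1\<close> by (intro add_nonneg_pos) auto
  qed
  with t show False
    by simp
qed

section \<open>Quadratic forms of moment sequences\<close>

text \<open>After multiplication by \<open>Gamma x\<close>, the form is the integral of a square
  against the weight \<open>s powr (x - 1) / exp s\<close>.\<close>

lemma pochhammer_quadratic_form_nonneg:
  fixes c :: "nat \<Rightarrow> real" and a :: "nat \<Rightarrow> nat"
  assumes "x > 0"
  shows "(\<Sum>i<m. \<Sum>j<m. c i * c j * pochhammer x (a i + a j)) \<ge> 0"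
proof -
  let ?g = "\<lambda>s. (\<Sum>i<m. c i * s ^ a i)\<^sup>2 * (s powr (x - 1) / exp s)"
  have g: "(\<Sum>i<m. \<Sum>j<m. c i * c j * (s powr (x + real (a i + a j) - 1) / exp s)) = ?g s"
    if "s \<in> {0..}" for s
  proof -
    \<comment> \<open>At \<open>s = 0\<close> both sides vanish, because \<open>0 powr y = 0\<close>
      for every \<open>y\<close>.\<close>
    have "s powr (x + real n - 1) = s ^ n * s powr (x - 1)" for n
      using that by (cases "s = 0") (auto simp: powr_add powr_diff powr_realpow)
    hence "(\<Sum>i<m. \<Sum>j<m. c i * c j * (s powr (x + real (a i + a j) - 1) / exp s))
        = (\<Sum>i<m. \<Sum>j<m. c i * c j * (s ^ (a i + a j) * s powr (x - 1) / exp s))"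
      by (simp only:)
    also have "\<dots> = ?g s"
      unfolding power2_eq_square sum_product
      unfolding sum_distrib_right by (simp add: power_add mult_ac)
    finally show ?thesis .
  qed
  have "((\<lambda>s. \<Sum>i<m. \<Sum>j<m. c i * c j * (s powr (x + real (a i + a j) - 1) / exp s)) has_integral
      (\<Sum>i<m. \<Sum>j<m. c i * c j * Gamma (x + real (a i + a j)))) {0..}"
    using assms
    by (intro has_integral_sum has_integral_mult_right Gamma_integral_real finite_lessThan) auto
  hence "(?g has_integral (\<Sum>i<m. \<Sum>j<m. c i * c j * Gamma (x + real (a i + a j)))) {0..}"
    by (subst (asm) has_integral_cong[OF g])
  hence "(\<Sum>i<m. \<Sum>j<m. c i * c j * Gamma (x + real (a i + a j))) \<ge> 0"
    by (rule has_integral_nonneg) auto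
  moreover have "Gamma x > 0"
    using assms by (rule Gamma_real_pos)
  moreover have "pochhammer x n = Gamma (x + real n) / Gamma x" for n
    using assms by (intro pochhammer_Gamma) (auto elim!: nonpos_Ints_cases)
  ultimately show ?thesis
    by (simp flip: sum_divide_distrib)
qed

lemma pochhammer_divide_Suc_quadratic_form_nonneg:
  fixes c :: "nat \<Rightarrow> real" and a :: "nat \<Rightarrow> nat"
  assumes "x > 0"
  shows "(\<Sum>i<m. \<Sum>j<m. c i * c j * (pochhammer x (a i + a j) / (real (a i + a j) + 1))) \<ge> 0"
proof -
  have power: "((\<lambda>u. u ^ n) has_integral 1 / (real n + 1)) {0..1::real}" for n
  proof -
    have "((\<lambda>u. u ^ n) has_integral 1 ^ Suc n / real (Suc n) - 0 ^ Suc n / real (Suc n)) {0..1::real}"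
      by (intro fundamental_theorem_of_calculus)
        (auto intro!: derivative_eq_intros
          simp del: power_Suc of_nat_Suc simp flip: has_real_derivative_iff_has_vector_derivative)
    thus ?thesis
      by (simp add: add.commute)
  qed
  have "((\<lambda>u. \<Sum>i<m. \<Sum>j<m. c i * c j * pochhammer x (a i + a j) * u ^ (a i + a j)) has_integral
      (\<Sum>i<m. \<Sum>j<m. c i * c j * pochhammer x (a i + a j) * (1 / (real (a i + a j) + 1)))) {0..1}"
    by (intro has_integral_sum has_integral_mult_right power finite_lessThan)
  \<comment> \<open>For fixed \<open>u\<close> the power splits as \<open>u ^ a i * u ^ a j\<close>
    and is absorbed into the coefficients.\<close>
  moreover have "(\<Sum>i<m. \<Sum>j<m. c i * c j * pochhammer x (a i + a j) * u ^ (a i + a j)) \<ge> 0" for u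
    using pochhammer_quadratic_form_nonneg[OF assms, of "\<lambda>i. c i * u ^ a i" a m]
    by (simp add: power_add mult_ac)
  ultimately have
    "(\<Sum>i<m. \<Sum>j<m. c i * c j * pochhammer x (a i + a j) * (1 / (real (a i + a j) + 1))) \<ge> 0"
    using has_integral_nonneg by blast
  thus ?thesis
    by simp
qed

section \<open>Integral representation of \<open>bernoulli2\<close>\<close>

text \<open>Passing from \<open>n\<close> to \<open>Suc n\<close> multiplies by
  \<open>(t - n) / (n + 1)\<close>, which has absolute value at most 1. The bound is uniform in
  \<open>t\<close>, as the M-test below requires.\<close>

lemma abs_gbinomial_le_1:
  fixes t :: real
  assumes "0 \<le> t" "t \<le> 1"
  shows "\<bar>t gchoose n\<bar> \<le> 1"
proof (induction n)
  case (Suc n)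
  have "real (Suc n) * (t gchoose Suc n) = (t - real n) * (t gchoose n)"
    using gbinomial_mult_1[of t n] by (simp add: algebra_simps)
  hence "real (Suc n) * \<bar>t gchoose Suc n\<bar> = \<bar>t - real n\<bar> * \<bar>t gchoose n\<bar>"
    by (metis abs_mult abs_of_nat)
  also have "\<dots> \<le> real (Suc n) * 1"
    using assms Suc by (intro mult_mono) auto
  finally show ?case
    by (simp only: mult_le_cancel_left_pos of_nat_0_less_iff zero_less_Suc)
qed simp

lemma continuous_on_gbinomial [continuous_intros]:
  "continuous_on S (\<lambda>t::real. t gchoose n)"
  by (auto simp: gbinomial_prod_rev intro!: continuous_intros)

lemma has_integral_powr_exponent:
  fixes x :: real
  assumes "x > 0" "x \<noteq> 1"
  shows "((\<lambda>t. x powr t) has_integral (x - 1) / ln x) {0..1}"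
proof -
  have "((\<lambda>t. x powr t / ln x) has_real_derivative x powr t) (at t within {0..1})" for t
  proof -
    have "((\<lambda>t. exp (t * ln x) / ln x) has_real_derivative exp (t * ln x)) (at t within {0..1})"
      using assms by (auto intro!: derivative_eq_intros)
    thus ?thesis
      using assms by (simp add: powr_def)
  qed
  hence "((\<lambda>t. x powr t) has_integral x powr 1 / ln x - x powr 0 / ln x) {0..1}"
    by (intro fundamental_theorem_of_calculus[where f = "\<lambda>t. x powr t / ln x"])
      (simp_all flip: has_real_derivative_iff_has_vector_derivative)
  thus ?thesis
    using assms by (simp add: diff_divide_distrib)
qed

lemma has_integral_bernoulli2: "((\<lambda>t. t gchoose n) has_integral bernoulli2 n) {0..1}"
proof -
  define \<beta> where "\<beta> n = integral {0..1} (\<lambda>t::real. t gchoose n)" for n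
  have \<beta>: "((\<lambda>t. t gchoose n) has_integral \<beta> n) {0..1}" for n
    unfolding \<beta>_def by (intro integrable_integral integrable_continuous_real continuous_intros)
  have "(\<lambda>n. \<beta> n * x ^ n) sums bernoulli2_gf x" if x: "\<bar>x\<bar> < 1" for x
  proof -
    let ?f = "\<lambda>N t. \<Sum>n<N. (t gchoose n) * x ^ n"
    \<comment> \<open>Uniform convergence in \<open>t\<close> permits termwise integration of the
      binomial series.\<close>
    have "uniform_limit {0..1} ?f (\<lambda>t. suminf (\<lambda>n. (t gchoose n) * x ^ n)) sequentially"
    proof (rule Weierstrass_m_test)
      show "norm ((t gchoose n) * x ^ n) \<le> \<bar>x\<bar> ^ n" if "t \<in> {0..1}" for n t
        using abs_gbinomial_le_1[of t n] that
        by (auto simp: abs_mult power_abs intro: mult_left_le_one_le)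
      show "summable (\<lambda>n. \<bar>x\<bar> ^ n)"
        using x by (intro summable_geometric) auto
    qed
    also have "(\<lambda>t. suminf (\<lambda>n. (t gchoose n) * x ^ n)) = (\<lambda>t. (1 + x) powr t)"
      using gen_binomial_real[OF x] by (simp add: sums_iff)
    finally have lim: "uniform_limit {0..1} ?f (\<lambda>t. (1 + x) powr t) sequentially" .
    obtain I J where IJ: "\<And>N. (?f N has_integral I N) {0..1}"
        "((\<lambda>t. (1 + x) powr t) has_integral J) {0..1}" "I \<longlonglongrightarrow> J"
      by (rule uniform_limit_integral[OF lim]) (auto intro!: continuous_intros)
    have "I = (\<lambda>N. \<Sum>n<N. \<beta> n * x ^ n)"
      by (rule ext, rule has_integral_unique[OF IJ(1)])
        (intro has_integral_sum has_integral_mult_left \<beta> finite_lessThan)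
    moreover have "J = bernoulli2_gf x"
    proof (rule has_integral_unique[OF IJ(2)])
      show "((\<lambda>t. (1 + x) powr t) has_integral bernoulli2_gf x) {0..1}"
      \<comment> \<open>At \<open>x = 0\<close> the closed form would divide by
        \<open>ln 1 = 0\<close>; there the integrand is constantly 1.\<close>
      proof (cases "x = 0")
        case True
        thus ?thesis
          using has_integral_const_real[of "1::real" 0 1] by (simp add: bernoulli2_gf_def)
      next
        case False
        thus ?thesis
          using has_integral_powr_exponent[of "1 + x"] x by (simp add: bernoulli2_gf_def)
      qed
    qed
    ultimately show ?thesis
      using IJ(3) by (simp add: sums_def)
  qed
  moreover have "eventually (\<lambda>x::real. \<bar>x\<bar> < 1) (nhds 0)"
    by (auto simp: eventually_nhds_metric dist_norm intro!: exI[of _ 1])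
  ultimately have "bernoulli2_gf has_fps_expansion Abs_fps \<beta>"
    by (intro has_fps_expansionI) (auto elim: eventually_mono)
  \<comment> \<open>Power series coefficients are unique.\<close>
  hence "\<beta> n = bernoulli2 n"
    using fps_nth_eq_iterated_deriv[of bernoulli2_gf "Abs_fps \<beta>" n] by (simp add: bernoulli2_def)
  with \<beta>[of n] show ?thesis
    by simp
qed

section \<open>Positivity for \<open>bernoulli2\<close>\<close>

text \<open>Split \<open>t\<close> off the product \<open>t * (t - 1) * ... * (t - n)\<close> and
  flip the other \<open>n\<close> signs; \<open>fact n / fact (Suc n)\<close> leaves
  \<open>1 / (n + 1)\<close>.\<close>

lemma gbinomial_Suc_pochhammer:
  fixes t :: real
  shows "(-1) ^ n * fact n * (t gchoose Suc n) = t * (pochhammer (1 - t) n / (real n + 1))"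
  by (simp add: gbinomial_pochhammer pochhammer_rec add.commute flip: power_mult_distrib)

lemma bernoulli2_quadratic_form_nonneg:
  fixes c :: "nat \<Rightarrow> real" and a :: "nat \<Rightarrow> nat"
  shows "(\<Sum>i<m. \<Sum>j<m. c i * c j *
      ((-1) ^ (a i + a j) * fact (a i + a j) * bernoulli2 (a i + a j + 1))) \<ge> 0"
proof -
  let ?f = "\<lambda>t. \<Sum>i<m. \<Sum>j<m. c i * c j *
      ((-1) ^ (a i + a j) * fact (a i + a j) * (t gchoose (a i + a j + 1)))"
  have "(?f has_integral (\<Sum>i<m. \<Sum>j<m. c i * c j *
      ((-1) ^ (a i + a j) * fact (a i + a j) * bernoulli2 (a i + a j + 1)))) {0..1}"
    by (intro has_integral_sum has_integral_mult_right has_integral_bernoulli2 finite_lessThan)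
  \<comment> \<open>The endpoint \<open>t = 1\<close> is dropped because the Pochhammer bound is
    available only for \<open>1 - t > 0\<close>.\<close>
  hence "(?f has_integral (\<Sum>i<m. \<Sum>j<m. c i * c j *
      ((-1) ^ (a i + a j) * fact (a i + a j) * bernoulli2 (a i + a j + 1)))) {0<..<1}"
    using has_integral_open_interval[of ?f _ 0 1] by simp
  thus ?thesis
  proof (rule has_integral_nonneg)
    fix t :: real
    assume t: "t \<in> {0<..<1}"
    have "?f t = t * (\<Sum>i<m. \<Sum>j<m. c i * c j *
        (pochhammer (1 - t) (a i + a j) / (real (a i + a j) + 1)))"
      unfolding Suc_eq_plus1[symmetric] gbinomial_Suc_pochhammer
      by (simp add: sum_distrib_left mult_ac)
    also have "\<dots> \<ge> 0"
      using t by (intro mult_nonneg_nonneg pochhammer_divide_Suc_quadratic_form_nonneg) auto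
    finally show "?f t \<ge> 0" .
  qed
qed

theorem theorem5p2:
  fixes m :: nat and a :: "nat \<Rightarrow> nat"
  assumes "m \<ge> 1"
  shows "Determinant.det (Matrix.mat m m (\<lambda>(i, j).
           fact (a (Suc i) + a (Suc j)) * bernoulli2 (a (Suc i) + a (Suc j) + 1))) \<ge> 0
       \<and> Determinant.det (Matrix.mat m m (\<lambda>(i, j).
           (-1) ^ (a (Suc i) + a (Suc j)) * fact (a (Suc i) + a (Suc j))
             * bernoulli2 (a (Suc i) + a (Suc j) + 1))) \<ge> 0"
proof (intro conjI det_mat_nonneg_if_pos_semidef)
  fix c :: "nat \<Rightarrow> real"
  show "0 \<le> (\<Sum>i<m. \<Sum>j<m. c i * c j * ((-1) ^ (a (Suc i) + a (Suc j))
      * fact (a (Suc i) + a (Suc j)) * bernoulli2 (a (Suc i) + a (Suc j) + 1)))"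
    by (rule bernoulli2_quadratic_form_nonneg)
  \<comment> \<open>Replacing \<open>c i\<close> by \<open>(-1) ^ a (Suc i) * c i\<close> cancels
    the sign \<open>(-1) ^ (p + q)\<close> of the entries.\<close>
  have "(-1) ^ p * x * ((-1) ^ q * y) * ((-1) ^ (p + q) * z * w) = x * y * (z * w)"
    for p q :: nat and x y z w :: real
    by (simp add: minus_one_power_iff)
  thus "0 \<le> (\<Sum>i<m. \<Sum>j<m. c i * c j *
      (fact (a (Suc i) + a (Suc j)) * bernoulli2 (a (Suc i) + a (Suc j) + 1)))"
    using bernoulli2_quadratic_form_nonneg
      [where m = m and c = "\<lambda>i. (-1) ^ a (Suc i) * c i" and a = "\<lambda>i. a (Suc i)"]
    by (simp only:)
qed

end
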